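(* Let $m = e^{-V}\mathcal{L}^1$ be a probability measure on $\mathbb{R}$ such that $V \in C^{\infty}(\mathbb{R})$ is $\kappa$-convex for some $\kappa>0$. Assume that $0$ is a minimizer of $V$ on $\mathbb{R}$. For any Borel subsets $A,B\subset \mathbb{R}$ with $m(A),m(B)>0$, set $\alpha_{m,A}:=\alpha_{m,\mu_{m,A}}$, $\alpha_{m,B}:=\alpha_{m,\mu_{m,B}}$ and \[ \Phi(m,A,B):=-\alpha_{m,B}\mathrm{bar}_m(A) - \alpha_{m,A}\mathrm{bar}_m(B) + \alpha_{m,A}\alpha_{m,B}+(\alpha_{m,A}+\alpha_{m,B})\mathrm{bar}(m). \] Then \[ m(A)m(B) \leq \exp\left(-\frac{\kappa }{2}d(A,B)^2 + \kappa\Phi(m,A,B)\right). \] In particular, when $m=\gamma_1$, setting \[ \Phi(A,B):=\Phi(\gamma_1,A,B)=-\alpha_{\gamma_1,B}\mathrm{bar}_{\gamma_1}(A) - \alpha_{\gamma_1,A}\mathrm{bar}_{\gamma_1}(B) + \alpha_{\gamma_1,A}\alpha_{\gamma_1,B}, \] we have \[ \gamma_1(A)\gamma_1(B) \leq \exp\left(-\frac{1}{2}d(A,B)^2 + \min\left\{\Phi(A,B), - \mathrm{bar}_{\gamma_1}(A)\mathrm{bar}_{\gamma_1}(B)\right\}\right). \]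
   Context: $\mathcal{L}^1$ is the Lebesgue measure on $\mathbb{R}$; $\gamma_1$ is the standard Gaussian measure on $\mathbb{R}$. A smooth $V$ is $\kappa$-convex iff $V''\ge\kappa$. $\mathrm{bar}(\mu)=\int x\,d\mu(x)$. For a Borel set $A$ with $m(A)>0$, $\mu_{m,A}:=m(A)^{-1}m|_A$ and $\mathrm{bar}_m(A):=\mathrm{bar}(\mu_{m,A})=m(A)^{-1}\int_A x\,dm(x)$. $d(A,B):=\inf\{|a-b| : a\in A, b\in B\}$. $\xi_m$ denotes the unique point at which the density of $m$ attains its maximum (here $\xi_m=0$). For a probability measure $\mu$ on $\mathbb{R}$, $\alpha_{m,\mu}:=T(\xi_m)$, where $T$ is the optimal transport map from $m$ to $\mu$, i.e. the monotone map $T=G^{-1}\circ F$ with $F(x)=m((-\infty,x])$, $G(x)=\mu((-\infty,x])$ and $G^{-1}(s)=\inf\{y\in\mathbb{R}: G(y)>s\}$ for $s\in(0,1)$. *)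

theory Defs
  imports "HOL-Probability.Probability"
begin

definition smooth_real :: "(real \<Rightarrow> real) \<Rightarrow> bool" where
  "smooth_real V \<longleftrightarrow> (\<forall>n x. (deriv ^^ n) V differentiable (at x))"

text \<open>Convexity with constant \<open>\<kappa>\<close> for smooth functions; only meaningful when \<open>V\<close> is twice differentiable.\<close>

definition kappa_convex :: "real \<Rightarrow> (real \<Rightarrow> real) \<Rightarrow> bool" where
  "kappa_convex \<kappa> V \<longleftrightarrow> (\<forall>x. \<kappa> \<le> deriv (deriv V) x)"

definition gibbs :: "(real \<Rightarrow> real) \<Rightarrow> real measure" where
  "gibbs V = density lborel (\<lambda>x. ennreal (exp (- V x)))"

definition bar :: "real measure \<Rightarrow> real" where
  "bar \<mu> = (\<integral>x. x \<partial>\<mu>)"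

definition bar_on :: "real measure \<Rightarrow> real set \<Rightarrow> real" where
  "bar_on m A = bar (uniform_measure m A)"

text \<open>The point at which the density of \<open>m\<close> attains its maximum. A density is determined by
  \<open>m\<close> only up to null sets; requiring the representative to be continuous makes it, and
  hence its maximiser, depend on \<open>m\<close> alone. Unspecified if there is no unique such point.\<close>

definition xi :: "real measure \<Rightarrow> real" where
  "xi m = (THE x. \<exists>f. continuous_on UNIV f \<and> (\<forall>y. 0 \<le> f y) \<and>
      m = density lborel (\<lambda>y. ennreal (f y)) \<and> (\<forall>y. f y \<le> f x))"

text \<open>The right-continuous inverse of the distribution function, meaningful for \<open>0 < s < 1\<close>.\<close>

definition quantile :: "real measure \<Rightarrow> real \<Rightarrow> real" where
  "quantile \<mu> s = Inf {y. cdf \<mu> y > s}"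

text \<open>On the line the optimal transport map is the monotone rearrangement.\<close>

definition transport_map :: "real measure \<Rightarrow> real measure \<Rightarrow> real \<Rightarrow> real" where
  "transport_map m \<mu> = quantile \<mu> \<circ> cdf m"

definition alpha :: "real measure \<Rightarrow> real measure \<Rightarrow> real" where
  "alpha m \<mu> = transport_map m \<mu> (xi m)"

definition alpha_on :: "real measure \<Rightarrow> real set \<Rightarrow> real" where
  "alpha_on m A = alpha m (uniform_measure m A)"

definition Phi :: "real measure \<Rightarrow> real set \<Rightarrow> real set \<Rightarrow> real" where
  "Phi m A B = - alpha_on m B * bar_on m A - alpha_on m A * bar_on m B
     + alpha_on m A * alpha_on m B + (alpha_on m A + alpha_on m B) * bar m"

end

theory Submission
  imports Defs
begin

text \<open>Let \<open>T\<close>, \<open>S\<close> be the monotone maps from \<open>m\<close> to the normalised restrictions of \<open>m\<close> to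
  \<open>A\<close>, \<open>B\<close>. The function \<open>p = m A * exp (V \<circ> T - V)\<close> satisfies \<open>\<integral> p \<le> T y - T x\<close> over \<open>[x, y]\<close>,
  so Jensen's inequality bounds increments of \<open>T\<close> below through the primitive of \<open>ln p\<close>.
  Strong convexity of \<open>V\<close> at \<open>x\<close>, tested at \<open>T x\<close> and \<open>S x\<close>, then bounds \<open>ln (m A) + ln (m B)\<close>
  pointwise in \<open>x\<close> by \<open>\<kappa>\<close> times an integrand for \<open>\<Phi> - (T - S)\<^sup>2 / 2\<close>, plus \<open>l - V' L\<close> with \<open>L\<close> a
  primitive of \<open>l\<close>, plus a multiple of \<open>V'\<close>. The last two terms have mean zero under
  \<open>exp (- V)\<close>, and \<open>\<bar>T - S\<bar>\<close> is at least the distance of \<open>A\<close> and \<open>B\<close> almost everywhere.\<close>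

subsection \<open>Monotone rearrangement on the line\<close>

context real_distribution
begin

lemma quantile_set_nonempty:
  assumes "s < 1"
  shows "{y. cdf M y > s} \<noteq> {}"
proof -
  have "\<forall>\<^sub>F y in at_top. s < cdf M y"
    using order_tendstoD(1)[OF cdf_lim_at_top_prob assms] .
  then show ?thesis
    by (auto dest!: eventually_happens)
qed

lemma quantile_set_bdd_below:
  assumes "0 < s"
  shows "bdd_below {y. cdf M y > s}"
proof -
  have "\<forall>\<^sub>F y in at_bot. cdf M y < s"
    using order_tendstoD(2)[OF cdf_lim_at_bot assms] .
  then obtain b where b: "cdf M b < s"
    by (auto dest!: eventually_happens)
  show ?thesis
  proof (rule bdd_belowI[of _ b])
    fix y assume "y \<in> {y. cdf M y > s}"
    then show "b \<le> y" using b cdf_nondecreasing[of y b] by (cases "y \<le> b") auto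
  qed
qed

lemma quantile_le:
  assumes "0 < s" "s < cdf M y"
  shows "quantile M s \<le> y"
  unfolding quantile_def using assms quantile_set_bdd_below by (intro cInf_lower) auto

text \<open>Every z > y lies strictly above the infimum defining the quantile, so
  \<open>s \<le> cdf M z\<close>; right-continuity of the distribution function carries this down to
  y itself, where the infimum need not be undercut.\<close>

lemma le_cdf_of_quantile_le:
  assumes "0 < s" "s < 1" "quantile M s \<le> y"
  shows "s \<le> cdf M y"
proof (rule tendsto_lowerbound)
  show "(cdf M \<longlongrightarrow> cdf M y) (at_right y)"
    using cdf_is_right_cont[of y] by (simp add: continuous_within)
  show "\<forall>\<^sub>F z in at_right y. s \<le> cdf M z"
    unfolding eventually_at_right_field
  proof (intro exI[of _ "y + 1"] conjI allI impI)
    fix z assume "z > y"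
    then have "Inf {y. cdf M y > s} < z"
      using assms(3) by (simp add: quantile_def)
    then obtain w where "cdf M w > s" "w < z"
      using cInf_lessD[OF quantile_set_nonempty[OF assms(2)]] by auto
    then show "s \<le> cdf M z"
      using cdf_nondecreasing[of w z] by simp
  qed simp
qed simp

lemma quantile_mono:
  assumes "0 < s" "s \<le> t" "t < 1"
  shows "quantile M s \<le> quantile M t"
  unfolding quantile_def
  using assms quantile_set_nonempty[of t] quantile_set_bdd_below[of s]
  by (intro cInf_superset_mono) auto

lemma cdf_pos: "strict_mono (cdf M) \<Longrightarrow> 0 < cdf M x"
  using cdf_nonneg[of "x - 1"] strict_monoD[of "cdf M" "x - 1" x] by simp

lemma cdf_less_1: "strict_mono (cdf M) \<Longrightarrow> cdf M x < 1"
  using cdf_bounded_prob[of "x + 1"] strict_monoD[of "cdf M" x "x + 1"] by simp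

lemma cdf_surj:
  assumes cont: "\<And>x. isCont (cdf M) x" and c: "0 < c" "c < 1"
  obtains x where "cdf M x = c"
proof -
  obtain l where l: "cdf M l < c"
    using order_tendstoD(2)[OF cdf_lim_at_bot c(1)] by (auto dest!: eventually_happens)
  obtain u where u: "c < cdf M u"
    using order_tendstoD(1)[OF cdf_lim_at_top_prob c(2)] by (auto dest!: eventually_happens)
  have "l \<le> u"
    using l u cdf_nondecreasing[of u l] by (cases "l \<le> u") auto
  then show ?thesis
    using IVT[of "cdf M" l c u] l u cont that by auto
qed

text \<open>Probability integral transform. The values 0 and 1 are never attained; any other c is
  attained at some x, and strict monotonicity turns the level sets into half-lines ending at x,
  which differ by a point without mass. Both versions are needed for the sandwich in
  \<open>distr_transport_map\<close>.\<close>

lemma cdf_uniform: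
  assumes cont: "\<And>x. isCont (cdf M) x" and strict: "strict_mono (cdf M)"
    and c: "0 \<le> c" "c \<le> 1"
  shows "measure M {x. cdf M x \<le> c} = c" "measure M {x. cdf M x < c} = c"
proof -
  consider "c = 0" | "c = 1" | "0 < c" "c < 1" using c by linarith
  then have "measure M {x. cdf M x \<le> c} = c \<and> measure M {x. cdf M x < c} = c"
  proof cases
    case 1
    have "{x. cdf M x \<le> c} = {}" "{x. cdf M x < c} = {}"
      using cdf_pos[OF strict] 1 by (auto simp: not_le not_less less_imp_le)
    then show ?thesis using 1 by simp
  next
    case 2
    have "{x. cdf M x \<le> c} = UNIV" "{x. cdf M x < c} = UNIV"
      using cdf_less_1[OF strict] 2 by (auto simp: less_imp_le)
    then show ?thesis using 2 prob_space by simp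
  next
    case 3
    then obtain x where x: "cdf M x = c" using cdf_surj[OF cont] by blast
    have "{y. cdf M y \<le> c} = {..x}" "{y. cdf M y < c} = {..<x}"
      using strict x by (auto simp: strict_mono_less_eq strict_mono_less)
    moreover have "measure M {..<x} = measure M {..x}"
      unfolding ivl_disj_un(2)[symmetric] using cont[of x]
      by (subst finite_measure_Union) (auto simp: isCont_cdf)
    ultimately show ?thesis using x by (simp add: cdf_def)
  qed
  then show "measure M {x. cdf M x \<le> c} = c" "measure M {x. cdf M x < c} = c" by auto
qed

lemma mono_transport_map:
  assumes "strict_mono (cdf M)" "real_distribution \<mu>"
  shows "mono (transport_map M \<mu>)"
  using real_distribution.quantile_mono[OF assms(2)] cdf_pos cdf_less_1 assms(1)
  by (auto simp: transport_map_def mono_def cdf_nondecreasing)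

text \<open>With F and G the distribution functions of source and target, the set where T is at most
  y lies between {F < G y} and {F \<le> G y}. Since F is uniformly distributed, both have mass G
  y.\<close>

lemma distr_transport_map:
  assumes cont: "\<And>x. isCont (cdf M) x" and strict: "strict_mono (cdf M)"
    and \<mu>: "real_distribution \<mu>"
  shows "distr M borel (transport_map M \<mu>) = \<mu>"
proof -
  interpret \<mu>: real_distribution \<mu> by fact
  let ?T = "transport_map M \<mu>"
  have [measurable]: "?T \<in> borel_measurable borel"
    by (rule borel_measurable_mono) (rule mono_transport_map[OF strict \<mu>])
  have [measurable]: "cdf M \<in> borel_measurable borel"
    by (rule borel_measurable_mono) (simp add: mono_def cdf_nondecreasing)
  show ?thesis
  proof (rule cdf_unique)
    show "real_distribution (distr M borel ?T)" by (rule real_distribution_distr) simp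
    show "real_distribution \<mu>" by fact
    show "cdf (distr M borel ?T) = cdf \<mu>"
    proof
      fix y
      have "cdf (distr M borel ?T) y = measure M {x. ?T x \<le> y}"
        by (simp add: cdf_def measure_distr vimage_def)
      moreover have "measure M {x. ?T x \<le> y} \<le> measure M {x. cdf M x \<le> cdf \<mu> y}"
        using \<mu>.le_cdf_of_quantile_le[of "cdf M _" y] cdf_pos[OF strict] cdf_less_1[OF strict]
        by (intro finite_measure_mono) (auto simp: transport_map_def)
      moreover have "measure M {x. cdf M x < cdf \<mu> y} \<le> measure M {x. ?T x \<le> y}"
      proof (rule finite_measure_mono)
        show "{x. cdf M x < cdf \<mu> y} \<subseteq> {x. ?T x \<le> y}"
          using \<mu>.quantile_le[of "cdf M _" y] cdf_pos[OF strict] by (auto simp: transport_map_def)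
      qed measurable
      ultimately show "cdf (distr M borel ?T) y = cdf \<mu> y"
        using cdf_uniform[OF cont strict \<mu>.cdf_nonneg \<mu>.cdf_bounded_prob] by simp
    qed
  qed
qed

end

subsection \<open>Strongly log-concave probability measures\<close>

lemma sets_gibbs [simp, measurable_cong]: "sets (gibbs V) = sets borel"
  by (simp add: gibbs_def)

lemma space_gibbs [simp]: "space (gibbs V) = UNIV"
  by (simp add: gibbs_def)

text \<open>Spends half of the exponential decay on a linear factor; this is what dominates
  \<open>V * exp (- V)\<close> by a Gaussian.\<close>

lemma le_exp_half:
  fixes t :: real
  assumes "0 \<le> t"
  shows "t * exp (- t) \<le> exp (- (t / 2))"
proof -
  \<comment> \<open>The difference of the two sides is the square of
    \<open>1 - t / 4\<close>.\<close>
  have "t \<le> (1 + t / 4)\<^sup>2"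
    using zero_le_power2[of "1 - t / 4"] by (simp add: power2_eq_square algebra_simps)
  also have "\<dots> \<le> (exp (t / 4))\<^sup>2"
    using exp_ge_add_one_self[of "t / 4"] assms by (intro power_mono) auto
  also have "\<dots> = exp (t / 2)" by (simp add: power2_eq_square flip: exp_add)
  finally have "t * exp (- t) \<le> exp (t / 2) * exp (- t)" by (intro mult_right_mono) auto
  then show ?thesis by (simp flip: exp_add)
qed

lemma integrable_gauss:
  assumes "0 < c"
  shows "integrable lborel (\<lambda>x::real. exp (- c * x\<^sup>2))"
proof -
  \<comment> \<open>The standard deviation for which the normal density has exponent
    \<open>- c * x\<^sup>2\<close>.\<close>
  define \<sigma> where "\<sigma> = 1 / sqrt (2 * c)"
  have \<sigma>: "2 * \<sigma>\<^sup>2 = 1 / c" using assms by (simp add: \<sigma>_def power_divide)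
  have "0 < \<sigma>" using assms by (simp add: \<sigma>_def)
  then have "exp (- c * x\<^sup>2) = sqrt (2 * pi * \<sigma>\<^sup>2) * normal_density 0 \<sigma> x" for x
    by (simp add: normal_density_def \<sigma>)
  moreover have "integrable lborel (\<lambda>x. sqrt (2 * pi * \<sigma>\<^sup>2) * normal_density 0 \<sigma> x)"
    by (intro integrable_mult_right integrable_normal_density \<open>0 < \<sigma>\<close>)
  ultimately show ?thesis by presburger
qed

text \<open>The hypotheses in first-order form: the bound \<kappa> on V'' becomes a growth bound on
  V', and the minimiser becomes a critical point. This form is stable under reflection in the
  origin, and with V' as a parameter the Gaussian is the instance where V' is the identity.\<close>

locale convex_gibbs =
  fixes V V' :: "real \<Rightarrow> real" and \<kappa> :: real
  assumes DERIV_V: "\<And>x. (V has_real_derivative V' x) (at x)"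
    and cont_V': "continuous_on UNIV V'"
    and kappa_pos: "0 < \<kappa>"
    and V'_growth: "\<And>x y. x \<le> y \<Longrightarrow> \<kappa> * (y - x) \<le> V' y - V' x"
    and V'_0: "V' 0 = 0"
    and prob_space_gibbs: "prob_space (gibbs V)"
begin

abbreviation "m \<equiv> gibbs V"

sublocale m: real_distribution m
  using prob_space_gibbs by (simp add: real_distribution_def real_distribution_axioms_def)

lemma isCont_V: "isCont V x"
  using DERIV_V DERIV_isCont by blast

lemma cont_V: "continuous_on S V"
  using isCont_V by (simp add: continuous_at_imp_continuous_on)

lemma V_measurable [measurable]: "V \<in> borel_measurable borel"
  using cont_V by (rule borel_measurable_continuous_onI)

lemma V'_measurable [measurable]: "V' \<in> borel_measurable borel"
  using cont_V' by (rule borel_measurable_continuous_onI)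

lemma nn_integral_m:
  "f \<in> borel_measurable borel \<Longrightarrow>
    (\<integral>\<^sup>+x. f x \<partial>m) = (\<integral>\<^sup>+x. ennreal (exp (- V x)) * f x \<partial>lborel)"
  unfolding gibbs_def by (subst nn_integral_density) auto

lemma integrable_m_iff:
  fixes f :: "real \<Rightarrow> real"
  shows "f \<in> borel_measurable borel \<Longrightarrow>
    integrable m f \<longleftrightarrow> integrable lborel (\<lambda>x. exp (- V x) * f x)"
  unfolding gibbs_def by (subst integrable_density) auto

lemma integral_m:
  fixes f :: "real \<Rightarrow> real"
  shows "f \<in> borel_measurable borel \<Longrightarrow>
    (\<integral>x. f x \<partial>m) = (\<integral>x. exp (- V x) * f x \<partial>lborel)"
  unfolding gibbs_def by (subst integral_density) auto

lemma AE_m_iff: "(AE x in m. P x) \<longleftrightarrow> (AE x in lborel. P x)"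
  unfolding gibbs_def by (subst AE_density) auto

text \<open>Subtracting the tangent and the quadratic from V leaves h, whose derivative at t has the
  sign of t - x by \<open>V'_growth\<close>; so h is minimal at x.\<close>

lemma strongly_convex: "V x + V' x * (y - x) + \<kappa> / 2 * (y - x)\<^sup>2 \<le> V y"
proof -
  define h where "h t = V t - V' x * (t - x) - \<kappa> / 2 * (t - x)\<^sup>2" for t
  have h: "(h has_real_derivative (V' t - V' x - \<kappa> * (t - x))) (at t)" for t
    unfolding h_def using DERIV_V[of t]
    by (auto intro!: derivative_eq_intros simp: field_simps)
  have "h x \<le> h y"
  proof (cases "x \<le> y")
    case True
    show ?thesis
      using V'_growth[of x] h
      by (intro DERIV_nonneg_imp_nondecreasing[OF True]) (auto intro!: exI simp: algebra_simps)
  next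
    case False
    then have le: "y \<le> x" by simp
    have "V' t - V' x - \<kappa> * (t - x) \<le> 0" if "t \<le> x" for t
      using V'_growth[OF that] by (simp add: algebra_simps)
    then show ?thesis
      using h by (intro DERIV_nonpos_imp_nonincreasing[OF le]) blast
  qed
  then show ?thesis by (simp add: h_def)
qed

lemma V_lower: "V 0 + \<kappa> / 2 * x\<^sup>2 \<le> V x"
  using strongly_convex[of 0 x] V'_0 by simp

lemma V'_ge: "0 \<le> x \<Longrightarrow> \<kappa> * x \<le> V' x"
  using V'_growth[of 0 x] V'_0 by simp

lemma V'_le: "x \<le> 0 \<Longrightarrow> V' x \<le> \<kappa> * x"
  using V'_growth[of x 0] V'_0 by simp

lemma V'_nonneg: "0 \<le> x \<Longrightarrow> 0 \<le> V' x"
  using V'_ge[of x] mult_nonneg_nonneg[of \<kappa> x] kappa_pos by linarith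

lemma V'_nonpos: "x \<le> 0 \<Longrightarrow> V' x \<le> 0"
  using V'_le[of x] mult_nonneg_nonpos[of \<kappa> x] kappa_pos by linarith

lemma integrable_V: "integrable m V"
proof -
  have "integrable m (\<lambda>x. V x - V 0)"
  proof (subst integrable_m_iff)
    show "integrable lborel (\<lambda>x. exp (- V x) * (V x - V 0))"
    proof (rule Bochner_Integration.integrable_bound)
      show "integrable lborel (\<lambda>x. exp (- V 0) * exp (- (\<kappa> / 4) * x\<^sup>2))"
        using integrable_gauss[of "\<kappa> / 4"] kappa_pos by (intro integrable_mult_right) simp
      show "AE x in lborel. norm (exp (- V x) * (V x - V 0))
          \<le> norm (exp (- V 0) * exp (- (\<kappa> / 4) * x\<^sup>2))"
      proof (rule AE_I2)
        fix x
        define t where "t = V x - V 0"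
        have t: "\<kappa> / 2 * x\<^sup>2 \<le> t" using V_lower[of x] by (simp add: t_def)
        moreover have "0 \<le> \<kappa> / 2 * x\<^sup>2" using kappa_pos by simp
        ultimately have t0: "0 \<le> t" by linarith
        have "t * exp (- t) \<le> exp (- (\<kappa> / 4) * x\<^sup>2)"
          using le_exp_half[OF t0] t by (elim order_trans) simp
        then have "exp (- V 0) * (t * exp (- t)) \<le> exp (- V 0) * exp (- (\<kappa> / 4) * x\<^sup>2)"
          by simp
        also have "exp (- V 0) * (t * exp (- t)) = exp (- V x) * (V x - V 0)"
          by (simp add: t_def exp_minus exp_diff field_simps)
        finally show "norm (exp (- V x) * (V x - V 0)) \<le> norm (exp (- V 0) * exp (- (\<kappa> / 4) * x\<^sup>2))"
          using t0 by (simp add: t_def abs_mult)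
      qed
    qed measurable
  qed measurable
  then have "integrable m (\<lambda>x. (V x - V 0) + V 0)"
    by (intro Bochner_Integration.integrable_add) auto
  then show ?thesis by simp
qed

lemma integrable_power2: "integrable m (\<lambda>x. x\<^sup>2)"
proof (rule Bochner_Integration.integrable_bound)
  show "integrable m (\<lambda>x. 2 / \<kappa> * (V x - V 0))"
    using integrable_V by (intro integrable_mult_right Bochner_Integration.integrable_diff) auto
  show "AE x in m. norm (x\<^sup>2) \<le> norm (2 / \<kappa> * (V x - V 0))"
  proof (rule AE_I2)
    fix x
    show "norm (x\<^sup>2) \<le> norm (2 / \<kappa> * (V x - V 0))"
      using V_lower[of x] kappa_pos by (simp add: field_simps abs_if)
  qed
qed measurable

text \<open>The density is positive everywhere, so an m-null interval would be
  Lebesgue-null.\<close>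

lemma cdf_strict_mono: "strict_mono (cdf m)"
proof (rule strict_monoI)
  fix x y :: real assume "x < y"
  have "measure m {x<..y} \<noteq> 0"
  proof
    assume "measure m {x<..y} = 0"
    then have "{x<..y} \<in> null_sets m"
      by (simp add: null_sets_def m.emeasure_eq_measure)
    then have "AE z in lborel. z \<notin> {x<..y}"
      by (metis AE_m_iff AE_not_in)
    then have "{x<..y} \<in> null_sets lborel"
      by (subst (asm) AE_iff_null_sets[symmetric]) auto
    then show False using \<open>x < y\<close> by (simp add: null_sets_def)
  qed
  then show "cdf m x < cdf m y"
    using m.cdf_diff_eq[OF \<open>x < y\<close>] measure_nonneg[of m "{x<..y}"] by linarith
qed

lemma isCont_cdf_m: "isCont (cdf m) x"
proof -
  have "AE z in m. z \<notin> {x}"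
    using AE_lborel_singleton[of x] by (simp add: AE_m_iff)
  then have "{x} \<in> null_sets m"
    by (subst (asm) AE_iff_null_sets[symmetric]) auto
  then show ?thesis by (simp add: m.isCont_cdf measure_def null_sets_def)
qed

end

subsection \<open>Integration by parts\<close>

text \<open>The signed kernel that expresses the integral from 0 to x, for x of either sign, as one
  integral over the line. In this form Fubini applies, and half-open intervals make differences of
  kernels exact indicators.\<close>

definition primitive_kernel :: "real \<Rightarrow> real \<Rightarrow> real" where
  "primitive_kernel x s = indicator {0<..x} s - indicator {x<..0} s"

definition primitive :: "(real \<Rightarrow> real) \<Rightarrow> real \<Rightarrow> real" where
  "primitive f x = (\<integral>s. primitive_kernel x s * f s \<partial>lborel)"

lemma primitive_0 [simp]: "primitive f 0 = 0"
  by (simp add: primitive_def primitive_kernel_def)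

lemma primitive_kernel_measurable [measurable]:
  "case_prod primitive_kernel \<in> borel_measurable (borel \<Otimes>\<^sub>M borel)"
proof -
  have "case_prod primitive_kernel = (\<lambda>(x, s). (if 0 < s \<and> s \<le> x then 1 else 0) - (if x < s \<and> s \<le> 0 then 1 else 0))"
    by (auto simp: primitive_kernel_def fun_eq_iff indicator_def)
  then show ?thesis by simp
qed

lemma primitive_kernel_diff: "x \<le> y \<Longrightarrow> primitive_kernel y s - primitive_kernel x s = indicator {x<..y} s"
  by (auto simp: primitive_kernel_def indicator_def)

context convex_gibbs
begin

lemma V_at_top: "filterlim V at_top at_top"
proof (rule filterlim_at_top_mono)
  show "LIM x at_top. (V 0 - \<kappa> / 2) + \<kappa> * x :> at_top"
    using kappa_pos
    by (intro filterlim_tendsto_add_at_top[OF tendsto_const]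
        filterlim_tendsto_pos_mult_at_top[OF tendsto_const _ filterlim_ident])
  have "(V 0 - \<kappa> / 2) + \<kappa> * x \<le> V x" for x
  proof -
    \<comment> \<open>Bounds the quadratic minorant of V below by its tangent line at 1.\<close>
    have "0 \<le> \<kappa> / 2 * (x - 1)\<^sup>2" using kappa_pos by simp
    then show ?thesis using V_lower[of x] by (simp add: power2_eq_square field_simps)
  qed
  then show "\<forall>\<^sub>F x in at_top. (V 0 - \<kappa> / 2) + \<kappa> * x \<le> V x" by simp
qed

text \<open>Transfers the integral over right half-lines to left half-lines.\<close>

lemma V_reflect: "convex_gibbs (\<lambda>x. V (- x)) (\<lambda>x. - V' (- x)) \<kappa>"
proof (rule convex_gibbs.intro)
  show "((\<lambda>x. V (- x)) has_real_derivative - V' (- x)) (at x)" for x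
    using DERIV_chain2[where f = V and g = uminus and x = x, OF DERIV_V[of "- x"] DERIV_minus[OF DERIV_ident]]
    by simp
  show "continuous_on UNIV (\<lambda>x. - V' (- x))"
    by (intro continuous_intros continuous_on_compose2[OF cont_V']) auto
  show "0 < \<kappa>" by (rule kappa_pos)
  show "\<kappa> * (y - x) \<le> - V' (- y) - - V' (- x)" if "x \<le> y" for x y
    using V'_growth[of "- y" "- x"] that by simp
  show "- V' (- 0) = 0" using V'_0 by simp
  show "prob_space (gibbs (\<lambda>x. V (- x)))"
  proof (rule prob_spaceI)
    have "emeasure (gibbs (\<lambda>x. V (- x))) UNIV = (\<integral>\<^sup>+x. ennreal (exp (- V (- x))) \<partial>lborel)"
      by (simp add: gibbs_def emeasure_density)
    also have "\<dots> = (\<integral>\<^sup>+x. ennreal (exp (- V x)) \<partial>lborel)"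
      by (subst nn_integral_real_affine[of _ "- 1" 0]) auto
    also have "\<dots> = emeasure m UNIV"
      by (simp add: gibbs_def emeasure_density)
    also have "\<dots> = 1" using m.emeasure_space_1 by simp
    finally show "emeasure (gibbs (\<lambda>x. V (- x))) (space (gibbs (\<lambda>x. V (- x)))) = 1" by simp
  qed
qed

text \<open>The antiderivative \<open>- exp (- V x)\<close> vanishes at infinity, and V' is
  nonnegative to the right of 0, so the fundamental theorem for nonnegative integrands yields
  integrability together with the value.\<close>

lemma has_integral_right:
  assumes "0 \<le> s"
  shows "has_bochner_integral lborel (\<lambda>x. exp (- V x) * V' x * indicator {s..} x) (exp (- V s))"
proof (rule has_bochner_integral_nn_integral)
  have "(\<integral>\<^sup>+x. ennreal (exp (- V x) * V' x) * indicator {s..} x \<partial>lborel) = ennreal (0 - - exp (- V s))"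
  proof (rule nn_integral_FTC_atLeast)
    show "((\<lambda>x. - exp (- V x)) has_real_derivative exp (- V x) * V' x) (at x)" for x
      using DERIV_V[of x] by (auto intro!: derivative_eq_intros)
    show "0 \<le> exp (- V x) * V' x" if "s \<le> x" for x
      using V'_nonneg[of x] assms that by simp
    have "((\<lambda>x. exp (- V x)) \<longlongrightarrow> 0) at_top"
      by (rule filterlim_compose[OF exp_at_bot])
         (rule filterlim_compose[OF filterlim_uminus_at_bot_at_top V_at_top])
    from tendsto_minus[OF this] show "((\<lambda>x. - exp (- V x)) \<longlongrightarrow> 0) at_top" by simp
  qed simp
  then show "(\<integral>\<^sup>+x. ennreal (exp (- V x) * V' x * indicator {s..} x) \<partial>lborel) = ennreal (exp (- V s))"
    by (simp add: nn_integral_set_ennreal)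
  show "AE x in lborel. 0 \<le> exp (- V x) * V' x * indicator {s..} x"
    using V'_nonneg assms by (intro AE_I2) (auto simp: indicator_def)
qed auto

lemma has_integral_left:
  assumes "s \<le> 0"
  shows "has_bochner_integral lborel (\<lambda>x. exp (- V x) * V' x * indicator {..s} x) (- exp (- V s))"
proof -
  interpret r: convex_gibbs "\<lambda>x. V (- x)" "\<lambda>x. - V' (- x)" \<kappa> by (rule V_reflect)
  have "has_bochner_integral lborel (\<lambda>x. exp (- V (- x)) * (- V' (- x)) * indicator {- s..} x) (exp (- V s))"
    using r.has_integral_right[of "- s"] assms by simp
  from has_bochner_integral_minus[OF this]
  have "has_bochner_integral lborel (\<lambda>x. exp (- V (- x)) * V' (- x) * indicator {- s..} x) (- exp (- V s))"
    by simp
  then show ?thesis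
    by (subst lborel_has_bochner_integral_real_affine_iff[where c="-1" and t=0])
       (auto simp: indicator_def le_minus_iff minus_le_iff)
qed

text \<open>The integrals over the two half-lines at 0 cancel; the shared endpoint is a null
  set.\<close>

lemma
  shows integrable_V': "integrable m V'" and integral_V': "(\<integral>x. V' x \<partial>m) = 0"
proof -
  have "has_bochner_integral lborel (\<lambda>x. exp (- V x) * V' x * indicator {0..} x
      + exp (- V x) * V' x * indicator {..0} x) (exp (- V 0) + - exp (- V 0))"
    by (intro has_bochner_integral_add has_integral_right has_integral_left) auto
  then have "has_bochner_integral lborel (\<lambda>x. exp (- V x) * V' x * indicator {0..} x
      + exp (- V x) * V' x * indicator {..0} x) 0" by simp
  then have "has_bochner_integral lborel (\<lambda>x. exp (- V x) * V' x) 0"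
    by (rule has_bochner_integral_discrete_difference[where X="{0}", THEN iffD1, rotated 4])
       (auto simp: indicator_def)
  then show "integrable m V'" "(\<integral>x. V' x \<partial>m) = 0"
    by (simp_all add: integrable_m_iff integral_m has_bochner_integral_iff)
qed

text \<open>As a function of x, the kernel is the indicator of the half-line from s rightwards if s
  > 0, and minus the indicator of the open half-line left of s otherwise. Either sign leads to
  \<open>exp (- V s)\<close>.\<close>

lemma has_integral_primitive_kernel:
  "has_bochner_integral lborel (\<lambda>x. exp (- V x) * V' x * primitive_kernel x s) (exp (- V s))"
proof (cases "0 < s")
  case True
  have "(\<lambda>x. primitive_kernel x s) = indicator {s..}"
    using True by (auto simp: primitive_kernel_def indicator_def)
  then show ?thesis using has_integral_right[of s] True by (auto simp: fun_eq_iff)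
next
  case False
  have "has_bochner_integral lborel (\<lambda>x. - (exp (- V x) * V' x * indicator {..s} x)) (exp (- V s))"
    using has_bochner_integral_minus[OF has_integral_left[of s]] False by simp
  then show ?thesis
    by (rule has_bochner_integral_discrete_difference[where X="{s}", THEN iffD1, rotated 4])
       (use False in \<open>auto simp: primitive_kernel_def indicator_def\<close>)
qed

lemma V'_primitive_kernel_nonneg: "0 \<le> V' x * primitive_kernel x s"
  using V'_nonneg[of x] V'_nonpos[of x] by (auto simp: primitive_kernel_def indicator_def)

text \<open>Integration by parts through Fubini, without boundary terms or differentiability of the
  primitive: integrating first in x collapses the kernel to \<open>exp (- V s)\<close>. Since
  \<open>V' x * primitive_kernel x s\<close> is nonnegative, the same computation with |f| gives
  absolute integrability.\<close>

lemma
  assumes [measurable]: "f \<in> borel_measurable borel" and f: "integrable m f"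
  shows integrable_V'_primitive: "integrable m (\<lambda>x. V' x * primitive f x)"
    and integral_V'_primitive: "(\<integral>x. V' x * primitive f x \<partial>m) = (\<integral>x. f x \<partial>m)"
proof -
  define g where "g s x = f s * (exp (- V x) * V' x * primitive_kernel x s)" for s x
  have [measurable]: "case_prod g \<in> borel_measurable (borel \<Otimes>\<^sub>M borel)"
    unfolding g_def by measurable
  have primitive_m [measurable]: "primitive f \<in> borel_measurable borel"
    unfolding primitive_def by measurable
  have intf: "integrable lborel (\<lambda>s. exp (- V s) * f s)"
    using f by (simp add: integrable_m_iff)
  have g: "integrable lborel (g s)" "(\<integral>x. g s x \<partial>lborel) = exp (- V s) * f s"
    "(\<integral>x. norm (g s x) \<partial>lborel) = norm (exp (- V s) * f s)" for s
  proof -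
    have k: "integrable lborel (\<lambda>x. exp (- V x) * V' x * primitive_kernel x s)"
      "(\<integral>x. exp (- V x) * V' x * primitive_kernel x s \<partial>lborel) = exp (- V s)"
      using has_integral_primitive_kernel[of s] by (auto simp: has_bochner_integral_iff)
    show "integrable lborel (g s)"
      unfolding g_def by (intro integrable_mult_right k)
    show "(\<integral>x. g s x \<partial>lborel) = exp (- V s) * f s"
      unfolding g_def using k by simp
    have "norm (g s x) = \<bar>f s\<bar> * (exp (- V x) * V' x * primitive_kernel x s)" for x
      using abs_of_nonneg[OF V'_primitive_kernel_nonneg[of x s]] by (simp add: g_def abs_mult mult.assoc)
    then show "(\<integral>x. norm (g s x) \<partial>lborel) = norm (exp (- V s) * f s)"
      using k by (simp add: abs_mult)
  qed
  have int: "integrable (lborel \<Otimes>\<^sub>M lborel) (case_prod g)"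
    using g intf by (intro lborel_pair.Fubini_integrable) auto
  have snd: "(\<integral>s. g s x \<partial>lborel) = exp (- V x) * (V' x * primitive f x)" for x
    by (simp add: g_def primitive_def mult_ac flip: integral_mult_right_zero)
  show "integrable m (\<lambda>x. V' x * primitive f x)"
    using lborel_pair.integrable_snd[OF int] by (simp add: snd integrable_m_iff)
  have "(\<integral>x. V' x * primitive f x \<partial>m) = (\<integral>x. (\<integral>s. g s x \<partial>lborel) \<partial>lborel)"
    by (simp add: integral_m snd)
  also have "\<dots> = (\<integral>s. (\<integral>x. g s x \<partial>lborel) \<partial>lborel)"
    by (rule lborel_pair.Fubini_integral[OF int])
  also have "\<dots> = (\<integral>x. f x \<partial>m)"
    by (simp add: g integral_m)
  finally show "(\<integral>x. V' x * primitive f x \<partial>m) = (\<integral>x. f x \<partial>m)" .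
qed

text \<open>V is bounded above by some c on a bounded set, by compactness, so there the density is
  at least \<open>exp (- c)\<close> and integrability against m gives integrability against Lebesgue
  measure.\<close>

lemma integrable_local:
  fixes f :: "real \<Rightarrow> real"
  assumes [measurable]: "f \<in> borel_measurable borel" and f: "integrable m f"
    and B: "B \<in> sets borel" "bounded B"
  shows "integrable lborel (\<lambda>s. indicator B s * f s)"
proof -
  note B(1)[measurable]
  obtain b where b: "\<And>s. s \<in> B \<Longrightarrow> \<bar>s\<bar> \<le> b"
    using B(2) by (auto simp: bounded_iff)
  have "compact (V ` {-b..b})"
    by (intro compact_continuous_image cont_V) auto
  then obtain c where c: "\<And>s. s \<in> {-b..b} \<Longrightarrow> V s \<le> c"
    by (metis bdd_above_def bounded_imp_bdd_above compact_imp_bounded imageI)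
  show ?thesis
  proof (rule Bochner_Integration.integrable_bound)
    show "integrable lborel (\<lambda>s. exp c * (exp (- V s) * f s))"
      using f by (simp add: integrable_m_iff)
    show "AE s in lborel. norm (indicator B s * f s) \<le> norm (exp c * (exp (- V s) * f s))"
    proof (rule AE_I2)
      fix s
      show "norm (indicator B s * f s) \<le> norm (exp c * (exp (- V s) * f s))"
      proof (cases "s \<in> B")
        case True
        then have "V s \<le> c" using b[of s] c[of s] by (simp add: abs_le_iff)
        then have "1 * \<bar>f s\<bar> \<le> exp (c - V s) * \<bar>f s\<bar>" by (intro mult_right_mono) auto
        then show ?thesis using True by (simp add: abs_mult exp_diff exp_minus field_simps)
      qed simp
    qed
  qed measurable
qed

lemma integrable_primitive_kernel:
  assumes [measurable]: "f \<in> borel_measurable borel" and f: "integrable m f"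
  shows "integrable lborel (\<lambda>s. primitive_kernel x s * f s)"
proof -
  have "integrable lborel (\<lambda>s. indicator {0<..x} s * f s - indicator {x<..0} s * f s)"
    by (intro Bochner_Integration.integrable_diff integrable_local f) auto
  then show ?thesis by (simp add: primitive_kernel_def left_diff_distrib)
qed

lemma primitive_diff:
  assumes [measurable]: "f \<in> borel_measurable borel" and f: "integrable m f" and "x \<le> y"
  shows "primitive f y - primitive f x = (\<integral>s. indicator {x<..y} s * f s \<partial>lborel)"
proof -
  have "primitive f y - primitive f x = (\<integral>s. (primitive_kernel y s * f s - primitive_kernel x s * f s) \<partial>lborel)"
    using integrable_primitive_kernel[OF _ f] by (simp add: primitive_def)
  then show ?thesis
    using primitive_kernel_diff[OF \<open>x \<le> y\<close>] by (simp flip: left_diff_distrib)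
qed

end

subsection \<open>The transport map to a restricted measure\<close>

locale convex_gibbs_set = convex_gibbs +
  fixes A :: "real set"
  assumes A_borel: "A \<in> sets borel" and A_pos: "0 < measure (gibbs V) A"
begin

definition T :: "real \<Rightarrow> real" where
  "T = transport_map m (uniform_measure m A)"

text \<open>At points of differentiability with \<open>T s \<in> A\<close> this is \<open>ln (T' s)\<close>, by the change of
  variables formula for the density \<open>exp (- V) / m A\<close> of the target; taking it as a definition
  avoids differentiating \<open>T\<close>.\<close>

definition log_jac :: "real \<Rightarrow> real" where
  "log_jac s = ln (measure m A) + V (T s) - V s"

abbreviation "\<mu> \<equiv> uniform_measure m A"

lemma emeasure_A: "emeasure m A \<noteq> 0" "emeasure m A \<noteq> \<infinity>"
  using A_pos by (simp_all add: m.emeasure_eq_measure)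

sublocale \<mu>: real_distribution \<mu>
  using prob_space_uniform_measure[OF emeasure_A]
  by (simp add: real_distribution_def real_distribution_axioms_def)

lemma mono_T: "mono T"
  unfolding T_def by (rule m.mono_transport_map[OF cdf_strict_mono \<mu>.real_distribution_axioms])

lemma T_measurable [measurable]: "T \<in> borel_measurable borel"
  using mono_T by (rule borel_measurable_mono)

lemma log_jac_measurable [measurable]: "log_jac \<in> borel_measurable borel"
  unfolding log_jac_def by measurable

lemma distr_T: "distr m borel T = \<mu>"
  unfolding T_def
  by (rule m.distr_transport_map[OF isCont_cdf_m cdf_strict_mono \<mu>.real_distribution_axioms])

lemma AE_T: "AE x in m. T x \<in> A"
proof -
  have "AE x in distr m borel T. x \<in> A"
    unfolding distr_T using AE_uniform_measureI[of A m "\<lambda>x. x \<in> A"] A_borel by simp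
  then show ?thesis using A_borel by (simp add: AE_distr_iff)
qed

text \<open>The law of T under m has density at most \<open>1 / measure m A\<close> with respect to
  m.\<close>

lemma integrable_comp_T:
  fixes f :: "real \<Rightarrow> real"
  assumes [measurable]: "f \<in> borel_measurable borel" and f: "integrable m f"
  shows "integrable m (\<lambda>x. f (T x))"
proof -
  have "integrable (distr m borel T) f"
    unfolding distr_T
  proof (subst integrable_iff_bounded, safe)
    have "(\<integral>\<^sup>+x. norm (f x) \<partial>\<mu>) = (\<integral>\<^sup>+x. ennreal (norm (f x)) * indicator A x \<partial>m) / emeasure m A"
      using A_borel by (subst nn_integral_uniform_measure) auto
    also have "\<dots> \<le> (\<integral>\<^sup>+x. norm (f x) \<partial>m) / emeasure m A"
      by (intro divide_right_mono_ennreal nn_integral_mono) (auto simp: indicator_def)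
    also have "\<dots> < \<infinity>"
      using f emeasure_A by (simp add: integrable_iff_bounded less_top[symmetric] ennreal_divide_eq_top_iff)
    finally show "(\<integral>\<^sup>+x. norm (f x) \<partial>\<mu>) < \<infinity>" .
  qed simp
  then show ?thesis by (subst (asm) integrable_distr_eq) auto
qed

lemma integrable_V_T: "integrable m (\<lambda>x. V (T x))"
  by (rule integrable_comp_T[OF _ integrable_V]) simp

lemma integrable_log_jac: "integrable m log_jac"
  unfolding log_jac_def using integrable_V integrable_V_T
  by (intro Bochner_Integration.integrable_add Bochner_Integration.integrable_diff) auto

lemma integrable_T_power2: "integrable m (\<lambda>x. (T x)\<^sup>2)"
  by (rule integrable_comp_T[OF _ integrable_power2]) simp

lemma integrable_T: "integrable m T"
  by (rule m.square_integrable_imp_integrable) (auto simp: integrable_T_power2)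

lemma integral_T: "(\<integral>x. T x \<partial>m) = bar_on m A"
proof -
  have "(\<integral>x. x \<partial>distr m borel T) = (\<integral>x. T x \<partial>m)"
    by (subst integral_distr) auto
  then show ?thesis by (simp add: distr_T bar_on_def bar_def)
qed

text \<open>The one-sided change of variables. Against m the integrand is
  \<open>measure m A * exp (V (T s))\<close>; pushed forward by T, this factor cancels the Lebesgue
  density of the target on A. What remains is the length of the part of A between T x and T y, at
  most \<open>T y - T x\<close>, so jumps of T do no harm.\<close>

lemma nn_integral_exp_log_jac:
  "(\<integral>\<^sup>+s. ennreal (exp (log_jac s)) * indicator {x<..y} s \<partial>lborel) \<le> ennreal (T y - T x)"
proof (cases "x \<le> y")
  case True
  define h where "h z = ennreal (measure m A * exp (V z)) * indicator {T x..T y} z" for z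
  have [measurable]: "h \<in> borel_measurable borel" unfolding h_def by simp
  have "exp (log_jac s) = exp (- V s) * (measure m A * exp (V (T s)))" for s
    using A_pos by (simp add: log_jac_def exp_add exp_diff exp_minus field_simps)
  then have "(\<integral>\<^sup>+s. ennreal (exp (log_jac s)) * indicator {x<..y} s \<partial>lborel)
      = (\<integral>\<^sup>+s. ennreal (measure m A * exp (V (T s))) * indicator {x<..y} s \<partial>m)"
    by (subst nn_integral_m) (auto simp: ennreal_mult' mult_ac)
  also have "\<dots> \<le> (\<integral>\<^sup>+s. h (T s) \<partial>m)"
    using monoD[OF mono_T] by (intro nn_integral_mono) (auto simp: h_def indicator_def)
  also have "\<dots> = (\<integral>\<^sup>+z. h z \<partial>\<mu>)"
    unfolding distr_T[symmetric] by (subst nn_integral_distr) auto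
  also have "\<dots> = (\<integral>\<^sup>+z. h z * indicator A z \<partial>m) / emeasure m A"
    using A_borel by (subst nn_integral_uniform_measure) auto
  also have "\<dots> \<le> (\<integral>\<^sup>+z. h z \<partial>m) / emeasure m A"
    by (intro divide_right_mono_ennreal nn_integral_mono) (auto simp: indicator_def)
  also have "(\<integral>\<^sup>+z. h z \<partial>m) = (\<integral>\<^sup>+z. ennreal (measure m A) * indicator {T x..T y} z \<partial>lborel)"
    by (subst nn_integral_m)
       (auto intro!: nn_integral_cong simp: h_def indicator_def exp_minus simp flip: ennreal_mult')
  also have "\<dots> = ennreal (measure m A) * ennreal (T y - T x)"
    using monoD[OF mono_T True] by (simp add: nn_integral_cmult_indicator)
  also have "\<dots> / emeasure m A = ennreal (T y - T x)"
    using A_pos monoD[OF mono_T True]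
    by (simp add: m.emeasure_eq_measure divide_ennreal flip: ennreal_mult')
  finally show ?thesis .
qed simp

text \<open>Jensen's inequality for the exponential, in the form of its tangent line at the mean of \<open>log_jac\<close>.\<close>

lemma T_increment:
  assumes "x < y"
  shows "(y - x) * exp ((primitive log_jac y - primitive log_jac x) / (y - x)) \<le> T y - T x"
proof -
  define c where "c = (primitive log_jac y - primitive log_jac x) / (y - x)"
  have ind: "has_bochner_integral lborel (\<lambda>s. indicator {x<..y} s :: real) (y - x)"
    using assms by (simp add: has_bochner_integral_iff)
  have log_jac: "has_bochner_integral lborel (\<lambda>s. indicator {x<..y} s * log_jac s) (c * (y - x))"
    using primitive_diff[OF _ integrable_log_jac, of x y] integrable_local[OF _ integrable_log_jac, of "{x<..y}"] assms
    by (simp add: c_def has_bochner_integral_iff)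
  have tangent: "has_bochner_integral lborel
      (\<lambda>s. exp c * (indicator {x<..y} s + indicator {x<..y} s * log_jac s - c * indicator {x<..y} s))
      (exp c * ((y - x) + c * (y - x) - c * (y - x)))"
    by (intro has_bochner_integral_mult_right has_bochner_integral_diff has_bochner_integral_add ind log_jac)
  have nn: "(\<integral>\<^sup>+s. ennreal (indicator {x<..y} s * exp (log_jac s)) \<partial>lborel) \<le> ennreal (T y - T x)"
    using nn_integral_exp_log_jac[of x y] by (simp add: nn_integral_set_ennreal mult.commute[of "indicator _ _"])
  have int: "integrable lborel (\<lambda>s. indicator {x<..y} s * exp (log_jac s))"
    using nn by (intro integrableI_nonneg) (auto simp: less_top[symmetric] top_unique)
  have "(y - x) * exp c
      = (\<integral>s. exp c * (indicator {x<..y} s + indicator {x<..y} s * log_jac s - c * indicator {x<..y} s) \<partial>lborel)"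
    using has_bochner_integral_integral_eq[OF tangent] by simp
  also have "\<dots> \<le> (\<integral>s. indicator {x<..y} s * exp (log_jac s) \<partial>lborel)"
  proof (rule integral_mono)
    show "integrable lborel (\<lambda>s. exp c * (indicator {x<..y} s + indicator {x<..y} s * log_jac s - c * indicator {x<..y} s))"
      using tangent by (rule integrable.intros)
    fix s
    have "exp c * (1 + (log_jac s - c)) \<le> exp c * exp (log_jac s - c)"
      by (intro mult_left_mono exp_ge_add_one_self) auto
    also have "\<dots> = exp (log_jac s)" by (simp flip: exp_add)
    finally have "exp c * (1 + log_jac s - c) \<le> exp (log_jac s)" by (simp add: add_diff_eq)
    then show "exp c * (indicator {x<..y} s + indicator {x<..y} s * log_jac s - c * indicator {x<..y} s)
        \<le> indicator {x<..y} s * exp (log_jac s)"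
      by (simp add: indicator_def)
  qed (rule int)
  also have "\<dots> \<le> T y - T x"
  proof -
    have "ennreal (\<integral>s. indicator {x<..y} s * exp (log_jac s) \<partial>lborel) \<le> ennreal (T y - T x)"
      using nn by (subst (asm) nn_integral_eq_integral[OF int]) auto
    then show ?thesis using monoD[OF mono_T, of x y] assms by (subst (asm) ennreal_le_iff) auto
  qed
  finally show ?thesis by (simp add: c_def)
qed

end

subsection \<open>The logarithmic inequality\<close>

lemma mult_exp_ge:
  fixes d p :: real
  assumes "0 < d"
  shows "d + p \<le> d * exp (p / d)"
proof -
  have "d * (1 + p / d) \<le> d * exp (p / d)"
    using assms by (intro mult_left_mono exp_ge_add_one_self) auto
  then show ?thesis using assms by (simp add: algebra_simps)
qed

text \<open>The exponentials are multiplied before linearising, so that p and q enter the bound on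
  the product only through their sum.\<close>

lemma mult_increments_ge:
  fixes d p q X Y :: real
  assumes "0 < d" "d * exp (p / d) \<le> X" "d * exp (q / d) \<le> Y"
  shows "d\<^sup>2 + d * (p + q) \<le> X * Y"
proof -
  have "d * (d + (p + q)) \<le> d * (d * exp ((p + q) / d))"
    using mult_exp_ge[of d "p + q"] assms by (intro mult_left_mono) auto
  also have "\<dots> = (d * exp (p / d)) * (d * exp (q / d))"
    by (simp add: add_divide_distrib exp_add)
  also have "\<dots> \<le> X * Y"
    using assms by (intro mult_mono) (auto intro: order_trans[rotated])
  finally show ?thesis by (simp add: power2_eq_square algebra_simps)
qed

text \<open>Split v into \<open>v - k * d\<close> and \<open>k * d\<close>. The first, nonnegative
  part uses the linear bounds p \<le> X - d and q \<le> Y - d; the second uses the product bound and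
  the expansion of \<open>X * Y - d\<^sup>2\<close> in X - d and Y - d.\<close>

lemma increments_ge:
  fixes d p q X Y k v :: real
  assumes d: "0 < d" and X: "d * exp (p / d) \<le> X" and Y: "d * exp (q / d) \<le> Y"
    and k: "0 \<le> k" "k * d \<le> v"
  shows "v * (p + q) \<le> v * (X - d) + v * (Y - d) + k * ((X - d) * (Y - d))"
proof -
  have "(v - k * d) * (p + q) \<le> (v - k * d) * (X + Y - 2 * d)"
    using mult_exp_ge[OF d, of p] mult_exp_ge[OF d, of q] X Y k by (intro mult_left_mono) auto
  moreover have "k * (d\<^sup>2 + d * (p + q)) \<le> k * (X * Y)"
    using mult_increments_ge[OF d X Y] k by (intro mult_left_mono) auto
  ultimately show ?thesis by (simp add: power2_eq_square algebra_simps)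
qed

locale convex_gibbs_pair = convex_gibbs + A: convex_gibbs_set V V' \<kappa> A + B: convex_gibbs_set V V' \<kappa> B
  for A B
begin

abbreviation "T \<equiv> A.T"
abbreviation "S \<equiv> B.T"

text \<open>This is \<open>exp V\<close> times the derivative of \<open>exp (- V)\<close> times the primitive of the two logarithms.\<close>

definition divergence :: "real \<Rightarrow> real" where
  "divergence x = (A.log_jac x + B.log_jac x) - V' x * (primitive A.log_jac x + primitive B.log_jac x)"

text \<open>\<open>increments_ge\<close> on the interval between 0 and x, where the primitives
  vanish at 0 and the slope |V' x| is at least \<kappa> |x|.\<close>

lemma primitive_log_jac_bound:
  defines "u \<equiv> \<lambda>x. T x - T 0 - x" and "v \<equiv> \<lambda>x. S x - S 0 - x"
  shows "V' x * (primitive A.log_jac x + primitive B.log_jac x) \<le> V' x * u x + V' x * v x + \<kappa> * (u x * v x)"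
proof -
  consider "x = 0" | "0 < x" | "x < 0" by linarith
  then show ?thesis
  proof cases
    case 2
    then show ?thesis
      using increments_ge[OF 2, of "primitive A.log_jac x" "T x - T 0" "primitive B.log_jac x" "S x - S 0" \<kappa> "V' x"]
        A.T_increment[OF 2] B.T_increment[OF 2] V'_ge[of x] kappa_pos
      by (simp add: u_def v_def)
  next
    case 3
    \<comment> \<open>The interval from x to 0 has length \<open>- x\<close> and slope
      \<open>- V' x\<close>; the signs cancel in the products.\<close>
    have "- V' x * (- primitive A.log_jac x + - primitive B.log_jac x) \<le>
        - V' x * (T 0 - T x - - x) + - V' x * (S 0 - S x - - x) + \<kappa> * ((T 0 - T x - - x) * (S 0 - S x - - x))"
      using A.T_increment[OF 3] B.T_increment[OF 3] V'_le[of x] kappa_pos 3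
      by (intro increments_ge) auto
    then show ?thesis by (simp add: u_def v_def algebra_simps)
  qed (simp add: u_def v_def V'_0)
qed

lemma log_measures_le:
  defines "a \<equiv> T 0" and "b \<equiv> S 0"
  shows "ln (measure m A) + ln (measure m B) \<le> divergence x - (a + b) * V' x
    + \<kappa> * (- (T x - S x)\<^sup>2 / 2 - b * T x - a * S x + a * b + (a + b) * x)"
proof -
  define u where "u = T x - T 0 - x"
  define v where "v = S x - S 0 - x"
  have T: "T x = u + a + x" and S: "S x = v + b + x"
    by (simp_all add: u_def v_def a_def b_def)
  have "V' x * (primitive A.log_jac x + primitive B.log_jac x) \<le> V' x * u + V' x * v + \<kappa> * (u * v)"
    using primitive_log_jac_bound[of x] by (simp add: u_def v_def)
  moreover have "V' x * (u + a) + \<kappa> / 2 * (u + a)\<^sup>2 + ln (measure m A) \<le> A.log_jac x"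
    using strongly_convex[of x "T x"] by (simp add: A.log_jac_def T add.assoc)
  moreover have "V' x * (v + b) + \<kappa> / 2 * (v + b)\<^sup>2 + ln (measure m B) \<le> B.log_jac x"
    using strongly_convex[of x "S x"] by (simp add: B.log_jac_def S add.assoc)
  \<comment> \<open>The terms in u and v multiplied by V' x cancel, leaving
    \<open>- (a + b) * V' x\<close>. With P = T x - x = u + a and Q = S x - x = v + b, the quadratic
    terms combine as - (P^2 + Q^2) / 2 + (P - a) (Q - b) = - (P - Q)^2 / 2 - b P - a Q + a b, and P
    - Q = T x - S x.\<close>
  ultimately show ?thesis
    by (simp add: divergence_def T S power2_eq_square field_simps)
qed

lemma integral_divergence: "integrable m divergence" "(\<integral>x. divergence x \<partial>m) = 0"
proof -
  note int = A.integrable_log_jac B.integrable_log_jac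
    integrable_V'_primitive[OF A.log_jac_measurable A.integrable_log_jac] integrable_V'_primitive[OF B.log_jac_measurable B.integrable_log_jac]
  have eq: "divergence = (\<lambda>x. (A.log_jac x - V' x * primitive A.log_jac x) + (B.log_jac x - V' x * primitive B.log_jac x))"
    by (simp add: divergence_def fun_eq_iff algebra_simps)
  show "integrable m divergence" unfolding eq using int by simp
  show "(\<integral>x. divergence x \<partial>m) = 0"
    unfolding eq using int
    by (simp add: integral_V'_primitive[OF A.log_jac_measurable A.integrable_log_jac] integral_V'_primitive[OF B.log_jac_measurable B.integrable_log_jac])
qed

lemma prob_UNIV [simp]: "measure m UNIV = 1"
  using m.prob_space by simp

lemma integrable_TS: "integrable m (\<lambda>x. T x * S x)"
proof (rule Bochner_Integration.integrable_bound)
  show "integrable m (\<lambda>x. (T x)\<^sup>2 + (S x)\<^sup>2)"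
    using A.integrable_T_power2 B.integrable_T_power2 by simp
  have "\<bar>T x * S x\<bar> \<le> (T x)\<^sup>2 + (S x)\<^sup>2" for x
    using sum_squares_bound[of "\<bar>T x\<bar>" "\<bar>S x\<bar>"] mult_nonneg_nonneg[of "\<bar>T x\<bar>" "\<bar>S x\<bar>"]
    unfolding abs_mult power2_abs by linarith
  then show "AE x in m. norm (T x * S x) \<le> norm ((T x)\<^sup>2 + (S x)\<^sup>2)" by simp
qed simp

lemma integrable_diff_power2: "integrable m (\<lambda>x. (T x - S x)\<^sup>2)"
proof -
  have "integrable m (\<lambda>x. (T x)\<^sup>2 + (S x)\<^sup>2 - 2 * (T x * S x))"
    using A.integrable_T_power2 B.integrable_T_power2 integrable_TS by simp
  then show ?thesis by (simp add: power2_diff mult.assoc)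
qed

text \<open>For almost every x the points T x and S x lie in A and B.\<close>

lemma setdist_le: "(setdist A B)\<^sup>2 \<le> (\<integral>x. (T x - S x)\<^sup>2 \<partial>m)"
proof -
  have "(\<integral>x. (setdist A B)\<^sup>2 \<partial>m) \<le> (\<integral>x. (T x - S x)\<^sup>2 \<partial>m)"
  proof (rule integral_mono_AE)
    show "AE x in m. (setdist A B)\<^sup>2 \<le> (T x - S x)\<^sup>2"
      using A.AE_T B.AE_T
    proof eventually_elim
      case (elim x)
      then have "setdist A B \<le> \<bar>T x - S x\<bar>"
        using setdist_le_dist[of "T x" A "S x" B] by (simp add: dist_real_def)
      then show ?case
        using power_mono[of "setdist A B" "\<bar>T x - S x\<bar>" 2] by (simp add: setdist_pos_le)
    qed
  qed (use integrable_diff_power2 in auto)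
  then show ?thesis by simp
qed

lemma integrable_id: "integrable m (\<lambda>x. x)"
  by (rule m.square_integrable_imp_integrable) (auto simp: integrable_power2)

lemma log_concentration:
  defines "a \<equiv> T 0" and "b \<equiv> S 0"
  shows "ln (measure m A) + ln (measure m B) \<le> - (\<kappa> / 2) * (setdist A B)\<^sup>2
    + \<kappa> * (- b * bar_on m A - a * bar_on m B + a * b + (a + b) * bar m)"
proof -
  have "(\<integral>x. ln (measure m A) + ln (measure m B) \<partial>m) \<le> (\<integral>x. divergence x - (a + b) * V' x
    + \<kappa> * (- (T x - S x)\<^sup>2 / 2 - b * T x - a * S x + a * b + (a + b) * x) \<partial>m)"
    using log_measures_le integral_divergence integrable_V' integrable_diff_power2 A.integrable_T B.integrable_T integrable_id
    by (intro integral_mono) (auto simp: a_def b_def)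
  also have "\<dots> = \<kappa> * (- (\<integral>x. (T x - S x)\<^sup>2 \<partial>m) / 2 - b * bar_on m A - a * bar_on m B + a * b + (a + b) * bar m)"
    using integral_divergence integrable_V' integral_V' integrable_diff_power2 A.integrable_T B.integrable_T integrable_id
    by (simp add: A.integral_T B.integral_T bar_def)
  also have "\<dots> \<le> \<kappa> * (- (setdist A B)\<^sup>2 / 2 - b * bar_on m A - a * bar_on m B + a * b + (a + b) * bar m)"
    using setdist_le kappa_pos by (intro mult_left_mono) auto
  finally show ?thesis by (simp add: algebra_simps)
qed

end

section \<open>Maximiser of the density and integrability of primitives\<close>

context convex_gibbs
begin

lemma xi_gibbs: "xi m = 0"
  unfolding xi_def
proof (rule the_equality)
  have "exp (- V y) \<le> exp (- V 0)" for y
  proof -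
    have "0 \<le> \<kappa> / 2 * y\<^sup>2" using kappa_pos by simp
    then show ?thesis using V_lower[of y] by simp
  qed
  moreover have "continuous_on UNIV (\<lambda>x. exp (- V x))"
    by (intro continuous_intros cont_V)
  ultimately show "\<exists>f. continuous_on UNIV f \<and> (\<forall>y. 0 \<le> f y) \<and>
      m = density lborel (\<lambda>y. ennreal (f y)) \<and> (\<forall>y. f y \<le> f 0)"
    by (intro exI[of _ "\<lambda>x. exp (- V x)"]) (auto simp: gibbs_def)
next
  fix x
  assume "\<exists>f. continuous_on UNIV f \<and> (\<forall>y. 0 \<le> f y) \<and>
      m = density lborel (\<lambda>y. ennreal (f y)) \<and> (\<forall>y. f y \<le> f x)"
  then obtain f where f: "continuous_on UNIV f" "\<And>y. 0 \<le> f y"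
    "m = density lborel (\<lambda>y. ennreal (f y))" "\<And>y. f y \<le> f x" by blast
  have [measurable]: "f \<in> borel_measurable borel"
    by (rule borel_measurable_continuous_onI[OF f(1)])
  have "AE y in lborel. ennreal (f y) = ennreal (exp (- V y))"
    using f(3) by (subst sigma_finite_measure.density_unique_iff[OF sigma_finite_lborel, symmetric]) (auto simp: gibbs_def)
  then have ae: "AE y in lborel. y \<in> {y. f y = exp (- V y)}"
    using f(2) by simp
  have "closed {y. f y = exp (- V y)}"
    using f(1) by (intro closed_Collect_eq continuous_intros cont_V)
  \<comment> \<open>Two continuous densities of m agree on a closed set of full Lebesgue measure,
    which is the whole line.\<close>
  then have eq: "f y = exp (- V y)" for y
    using mem_closed_if_AE_lebesgue[OF _ AE_completion[OF ae]] by blast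
  have "V x \<le> V 0" using f(4)[of 0] by (simp add: eq)
  then have "\<kappa> / 2 * x\<^sup>2 \<le> 0" using V_lower[of x] by linarith
  then show "x = 0" using kappa_pos by (simp add: mult_le_0_iff)
qed

text \<open>Outside [-1, 1] the factor |V'| is at least \<kappa>, so the integrable
  \<open>V' x * primitive f x\<close> dominates; inside, the local integral of |f| is a bound. The
  Gaussian case needs the primitive without the factor V'.\<close>

lemma integrable_primitive:
  assumes [measurable]: "f \<in> borel_measurable borel" and f: "integrable m f"
  shows "integrable m (primitive f)"
proof -
  have [measurable]: "primitive f \<in> borel_measurable borel"
    unfolding primitive_def by measurable
  define C where "C = (\<integral>s. indicator {-1..1} s * \<bar>f s\<bar> \<partial>lborel)"
  have int: "integrable lborel (\<lambda>s. indicator {-1..1} s * \<bar>f s\<bar>)"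
    using f by (intro integrable_local) auto
  have C: "0 \<le> C" unfolding C_def by (intro integral_nonneg_AE) auto
  have "\<bar>primitive f x\<bar> \<le> C + \<bar>V' x * primitive f x\<bar> / \<kappa>" for x
  proof (cases "\<bar>x\<bar> \<le> 1")
    case True
    have k: "integrable lborel (\<lambda>s. primitive_kernel x s * f s)"
      using f by (intro integrable_primitive_kernel) auto
    have "\<bar>primitive f x\<bar> \<le> (\<integral>s. \<bar>primitive_kernel x s * f s\<bar> \<partial>lborel)"
      unfolding primitive_def by (rule integral_abs_bound)
    also have "\<dots> \<le> C"
      unfolding C_def
    proof (rule integral_mono[OF integrable_abs[OF k] int])
      show "\<bar>primitive_kernel x s * f s\<bar> \<le> indicator {-1..1} s * \<bar>f s\<bar>" for s
        using True by (auto simp: primitive_kernel_def indicator_def)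
    qed
    finally have "\<bar>primitive f x\<bar> \<le> C" .
    then show ?thesis using kappa_pos by (simp add: add_increasing2)
  next
    case False
    have "\<kappa> * 1 \<le> \<kappa> * \<bar>x\<bar>" using False kappa_pos by (intro mult_left_mono) auto
    also have "\<dots> \<le> \<bar>V' x\<bar>"
      using V'_ge[of x] V'_le[of x] by (cases "0 \<le> x") auto
    finally have "\<kappa> * \<bar>primitive f x\<bar> \<le> \<bar>V' x\<bar> * \<bar>primitive f x\<bar>"
      by (intro mult_right_mono) auto
    then have "\<bar>primitive f x\<bar> \<le> \<bar>V' x * primitive f x\<bar> / \<kappa>"
      using kappa_pos by (simp add: field_simps abs_mult)
    then show ?thesis using C by linarith
  qed
  then have "AE x in m. norm (primitive f x) \<le> norm (C + \<bar>V' x * primitive f x\<bar> / \<kappa>)"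
    unfolding real_norm_def by (intro AE_I2 order_trans[OF _ abs_ge_self])
  moreover have "integrable m (\<lambda>x. C + \<bar>V' x * primitive f x\<bar> / \<kappa>)"
    using integrable_V'_primitive[OF _ f] by simp
  moreover have "primitive f \<in> borel_measurable m" by simp
  ultimately show ?thesis
    using Bochner_Integration.integrable_bound by blast
qed

end

section \<open>The concentration inequality and its Gaussian refinement\<close>

context convex_gibbs_pair
begin

lemma alpha_on_eq: "alpha_on m A = T 0" "alpha_on m B = S 0"
  by (simp_all add: alpha_on_def alpha_def xi_gibbs A.T_def B.T_def)

lemma exp_bound:
  assumes "ln (measure m A) + ln (measure m B) \<le> c"
  shows "measure m A * measure m B \<le> exp c"
proof -
  have "exp (ln (measure m A) + ln (measure m B)) \<le> exp c" using assms by simp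
  then show ?thesis using A.A_pos B.A_pos by (simp add: exp_add)
qed

lemma concentration:
  "measure m A * measure m B \<le> exp (- (\<kappa> / 2) * (setdist A B)\<^sup>2 + \<kappa> * Phi m A B)"
  using log_concentration by (intro exp_bound) (simp add: Phi_def alpha_on_eq)

text \<open>Both sides are symmetric in x and y, so the case y < x, which is
  \<open>mult_increments_ge\<close>, suffices.\<close>

lemma increments_product_ge:
  "(x - y)\<^sup>2 + (x - y) * ((primitive A.log_jac x + primitive B.log_jac x) - (primitive A.log_jac y + primitive B.log_jac y))
    \<le> (T x - T y) * (S x - S y)"
proof -
  have *: "(x - y)\<^sup>2 + (x - y) * ((primitive A.log_jac x + primitive B.log_jac x) - (primitive A.log_jac y + primitive B.log_jac y))
    \<le> (T x - T y) * (S x - S y)" if "y < x" for x y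
    using mult_increments_ge[OF _ A.T_increment[OF that] B.T_increment[OF that]] that
    by (simp add: algebra_simps)
  consider "x = y" | "y < x" | "x < y" by linarith
  then show ?thesis
    using *[of y x] *[of x y] by cases (simp_all add: power2_eq_square algebra_simps)
qed

text \<open>The covariance of \<open>T\<close> and \<open>S\<close> is half the double integral of
  \<open>(T x - T y) * (S x - S y)\<close>; this replaces the expansion around the origin.\<close>

lemma log_concentration_gaussian:
  assumes V: "\<And>x. V x = x\<^sup>2 / 2 + C" and V': "\<And>x. V' x = x" and moment: "(\<integral>x. x\<^sup>2 \<partial>m) = 1"
  shows "ln (measure m A) + ln (measure m B)
    \<le> - (1 / 2) * (setdist A B)\<^sup>2 + - bar_on m A * bar_on m B"
proof -
  define L where "L x = primitive A.log_jac x + primitive B.log_jac x" for x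
  define l where "l = (\<integral>x. A.log_jac x \<partial>m) + (\<integral>x. B.log_jac x \<partial>m)"
  have mean: "(\<integral>x. x \<partial>m) = 0" using integral_V' by (simp add: V')
  have L: "integrable m L"
    unfolding L_def using integrable_primitive A.integrable_log_jac B.integrable_log_jac by simp
  have pA: "integrable m (\<lambda>x. x * primitive A.log_jac x)" "(\<integral>x. x * primitive A.log_jac x \<partial>m) = (\<integral>x. A.log_jac x \<partial>m)"
    using integrable_V'_primitive[OF A.log_jac_measurable A.integrable_log_jac]
      integral_V'_primitive[OF A.log_jac_measurable A.integrable_log_jac] by (simp_all add: V')
  have pB: "integrable m (\<lambda>x. x * primitive B.log_jac x)" "(\<integral>x. x * primitive B.log_jac x \<partial>m) = (\<integral>x. B.log_jac x \<partial>m)"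
    using integrable_V'_primitive[OF B.log_jac_measurable B.integrable_log_jac]
      integral_V'_primitive[OF B.log_jac_measurable B.integrable_log_jac] by (simp_all add: V')
  have xL: "integrable m (\<lambda>x. x * L x)" "(\<integral>x. x * L x \<partial>m) = l"
    using pA pB by (simp_all add: L_def l_def distrib_left)
  note int = L xL integrable_TS A.integrable_T B.integrable_T integrable_id integrable_power2
  \<comment> \<open>Integrates \<open>increments_product_ge\<close> in x for fixed y: the second
    moment gives 1, \<open>x * L x\<close> gives l, and terms linear in x vanish because the mean is
    0.\<close>
  have inner: "1 + y\<^sup>2 + l - y * (\<integral>x. L x \<partial>m) + y * L y
      \<le> (\<integral>x. T x * S x \<partial>m) - T y * bar_on m B - S y * bar_on m A + T y * S y" for y
  proof -
    have "(\<integral>x. (x\<^sup>2 - 2 * y * x + y\<^sup>2) + (x * L x - L y * x - y * L x + y * L y) \<partial>m)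
        \<le> (\<integral>x. T x * S x - T y * S x - S y * T x + T y * S y \<partial>m)"
    proof (rule integral_mono)
      show "integrable m (\<lambda>x. (x\<^sup>2 - 2 * y * x + y\<^sup>2) + (x * L x - L y * x - y * L x + y * L y))"
        "integrable m (\<lambda>x. T x * S x - T y * S x - S y * T x + T y * S y)"
        using int by simp_all
      show "(x\<^sup>2 - 2 * y * x + y\<^sup>2) + (x * L x - L y * x - y * L x + y * L y)
          \<le> T x * S x - T y * S x - S y * T x + T y * S y" for x
        using increments_product_ge[of x y]
        by (simp add: L_def power2_eq_square algebra_simps)
    qed
    then show ?thesis
      using int mean moment by (simp add: A.integral_T B.integral_T)
  qed
  have "(\<integral>y. 1 + y\<^sup>2 + l - y * (\<integral>x. L x \<partial>m) + y * L y \<partial>m)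
      \<le> (\<integral>y. (\<integral>x. T x * S x \<partial>m) - T y * bar_on m B - S y * bar_on m A + T y * S y \<partial>m)"
    using int inner by (intro integral_mono) simp_all
  \<comment> \<open>Integrating in y doubles both sides, to \<open>2 + 2 * l\<close> and twice the
    covariance.\<close>
  then have cov: "1 + l \<le> (\<integral>x. T x * S x \<partial>m) - bar_on m A * bar_on m B"
    using int mean moment xL(2) by (simp add: A.integral_T B.integral_T)
  \<comment> \<open>For a quadratic potential strong convexity is an identity, and the constant C
    cancels in each \<open>log_jac\<close>.\<close>
  have "ln (measure m A) + ln (measure m B)
      = A.log_jac x + B.log_jac x + x\<^sup>2 - T x * S x - (T x - S x)\<^sup>2 / 2" for x
    by (simp add: A.log_jac_def B.log_jac_def V power2_eq_square field_simps)
  then have "(\<integral>x. ln (measure m A) + ln (measure m B) \<partial>m)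
      = (\<integral>x. A.log_jac x + B.log_jac x + x\<^sup>2 - T x * S x - (T x - S x)\<^sup>2 / 2 \<partial>m)"
    by (intro Bochner_Integration.integral_cong) auto
  also have "\<dots> = l + 1 - (\<integral>x. T x * S x \<partial>m) - (\<integral>x. (T x - S x)\<^sup>2 \<partial>m) / 2"
    using int integrable_diff_power2 A.integrable_log_jac B.integrable_log_jac moment by (simp add: l_def)
  finally show ?thesis using cov setdist_le by simp
qed

end

section \<open>Smooth convex potentials and the Gaussian as instances\<close>

lemma convex_gibbs_deriv:
  assumes V: "smooth_real V" and \<kappa>: "0 < \<kappa>" "kappa_convex \<kappa> V" and prob: "prob_space (gibbs V)"
    and min: "\<forall>x. V 0 \<le> V x"
  shows "convex_gibbs V (deriv V) \<kappa>"
proof (rule convex_gibbs.intro)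
  have "V differentiable (at x)" for x
    using V[unfolded smooth_real_def, rule_format, of 0 x] by simp
  then show V': "(V has_real_derivative deriv V x) (at x)" for x
    using DERIV_deriv_iff_real_differentiable by blast
  have "deriv V differentiable (at x)" for x
    using V[unfolded smooth_real_def, rule_format, of 1 x] by simp
  then have V'': "(deriv V has_real_derivative deriv (deriv V) x) (at x)" for x
    using DERIV_deriv_iff_real_differentiable by blast
  then show "continuous_on UNIV (deriv V)"
    by (intro continuous_at_imp_continuous_on) (blast intro: DERIV_isCont)
  show "\<kappa> * (y - x) \<le> deriv V y - deriv V x" if "x \<le> y" for x y
  proof -
    have "deriv V x - \<kappa> * x \<le> deriv V y - \<kappa> * y"
    proof (rule DERIV_nonneg_imp_nondecreasing[OF that, of "\<lambda>t. deriv V t - \<kappa> * t"])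
      fix t
      have "((\<lambda>t. deriv V t - \<kappa> * t) has_real_derivative (deriv (deriv V) t - \<kappa>)) (at t)"
        using V''[of t] by (auto intro!: derivative_eq_intros)
      moreover have "0 \<le> deriv (deriv V) t - \<kappa>" using \<kappa>(2) by (simp add: kappa_convex_def)
      ultimately show "\<exists>z. ((\<lambda>t. deriv V t - \<kappa> * t) has_real_derivative z) (at t) \<and> 0 \<le> z" by blast
    qed
    then show ?thesis by (simp add: algebra_simps)
  qed
  show "deriv V 0 = 0"
    using DERIV_local_min[OF V', of 1] min by simp
qed (use \<kappa> prob in auto)

lemma std_normal_eq_gibbs: "std_normal_distribution = gibbs (\<lambda>x. x\<^sup>2 / 2 + ln (sqrt (2 * pi)))"
proof -
  have "std_normal_density x = exp (- (x\<^sup>2 / 2 + ln (sqrt (2 * pi))))" for x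
    by (simp add: std_normal_density_def exp_diff exp_minus)
  then show ?thesis by (simp add: gibbs_def)
qed

lemma convex_gibbs_gaussian: "convex_gibbs (\<lambda>x. x\<^sup>2 / 2 + ln (sqrt (2 * pi))) (\<lambda>x. x) 1"
  by (rule convex_gibbs.intro)
     (auto intro!: derivative_eq_intros simp: prob_space_normal_density simp flip: std_normal_eq_gibbs)

theorem theorem6p1:
  shows "(\<forall>(V :: real \<Rightarrow> real) (\<kappa> :: real) (A :: real set) (B :: real set).
            smooth_real V \<longrightarrow> 0 < \<kappa> \<longrightarrow> kappa_convex \<kappa> V \<longrightarrow>
            prob_space (gibbs V) \<longrightarrow> (\<forall>x. V 0 \<le> V x) \<longrightarrow>
            A \<in> sets borel \<longrightarrow> B \<in> sets borel \<longrightarrow>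
            0 < measure (gibbs V) A \<longrightarrow> 0 < measure (gibbs V) B \<longrightarrow>
            measure (gibbs V) A * measure (gibbs V) B
              \<le> exp (- (\<kappa> / 2) * (setdist A B)\<^sup>2 + \<kappa> * Phi (gibbs V) A B))
       \<and> (\<forall>(A :: real set) (B :: real set).
            A \<in> sets borel \<longrightarrow> B \<in> sets borel \<longrightarrow>
            0 < measure std_normal_distribution A \<longrightarrow> 0 < measure std_normal_distribution B \<longrightarrow>
            Phi std_normal_distribution A B
              = - alpha_on std_normal_distribution B * bar_on std_normal_distribution A - alpha_on std_normal_distribution A * bar_on std_normal_distribution B
                + alpha_on std_normal_distribution A * alpha_on std_normal_distribution B \<and>
            measure std_normal_distribution A * measure std_normal_distribution B
              \<le> exp (- (1 / 2) * (setdist A B)\<^sup>2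
                  + min (Phi std_normal_distribution A B) (- bar_on std_normal_distribution A * bar_on std_normal_distribution B)))"
proof (intro conjI allI impI)
  fix V :: "real \<Rightarrow> real" and \<kappa> :: real and A B :: "real set"
  assume "smooth_real V" "0 < \<kappa>" "kappa_convex \<kappa> V" "prob_space (gibbs V)" "\<forall>x. V 0 \<le> V x"
    and AB: "A \<in> sets borel" "B \<in> sets borel" "0 < measure (gibbs V) A" "0 < measure (gibbs V) B"
  then interpret convex_gibbs V "deriv V" \<kappa> by (intro convex_gibbs_deriv)
  interpret convex_gibbs_pair V "deriv V" \<kappa> A B
    by standard (use AB in auto)
  show "measure (gibbs V) A * measure (gibbs V) B
      \<le> exp (- (\<kappa> / 2) * (setdist A B)\<^sup>2 + \<kappa> * Phi (gibbs V) A B)"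
    by (rule concentration)
next
  fix A B :: "real set"
  have "bar std_normal_distribution = 0"
    using integral_std_normal_distribution_moment_odd[of 1] by (simp add: bar_def)
  then show "Phi std_normal_distribution A B
      = - alpha_on std_normal_distribution B * bar_on std_normal_distribution A - alpha_on std_normal_distribution A * bar_on std_normal_distribution B
        + alpha_on std_normal_distribution A * alpha_on std_normal_distribution B"
    by (simp add: Phi_def)
  assume AB: "A \<in> sets borel" "B \<in> sets borel"
    "0 < measure std_normal_distribution A" "0 < measure std_normal_distribution B"
  let ?V = "\<lambda>x::real. x\<^sup>2 / 2 + ln (sqrt (2 * pi))"
  interpret convex_gibbs ?V "\<lambda>x. x" 1 by (rule convex_gibbs_gaussian)
  interpret convex_gibbs_pair ?V "\<lambda>x. x" 1 A B
    by standard (use AB in \<open>auto simp: std_normal_eq_gibbs\<close>)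
  have moment: "(\<integral>x. x\<^sup>2 \<partial>gibbs ?V) = 1"
    using std_normal_distribution_even_moments(1)[of 1] by (simp add: std_normal_eq_gibbs)
  \<comment> \<open>The two entries of the minimum come from separate arguments: the expansion
    around the origin with \<kappa> = 1, and the covariance estimate.\<close>
  have "measure (gibbs ?V) A * measure (gibbs ?V) B
      \<le> exp (- (1 / 2) * (setdist A B)\<^sup>2 + min (Phi (gibbs ?V) A B) (- bar_on (gibbs ?V) A * bar_on (gibbs ?V) B))"
    using concentration exp_bound[OF log_concentration_gaussian[OF refl refl moment]]
    by (cases "Phi (gibbs ?V) A B \<le> - bar_on (gibbs ?V) A * bar_on (gibbs ?V) B")
      (simp_all only: min_def if_True if_False mult_1)
  then show "measure std_normal_distribution A * measure std_normal_distribution B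
      \<le> exp (- (1 / 2) * (setdist A B)\<^sup>2
          + min (Phi std_normal_distribution A B) (- bar_on std_normal_distribution A * bar_on std_normal_distribution B))"
    by (simp only: std_normal_eq_gibbs)
qed

end
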